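(* Let $\Omega$ be a closed Jordan domain contained in the open rectangle $\mathbf{R}=\{(x,y)\mid a<x<b,\ c<y<d\}$, and let $f(x,y)$ be a Riemann integrable function on $\Omega$. Suppose that the set of points of discontinuity of $f$ has zero Jordan measure. Let $\varepsilon_1>\varepsilon_2>\cdots$ be a sequence of positive numbers with $\varepsilon_n\to0$, with associated nested coverings $\Delta_{\varepsilon_n}$ of the set of points of discontinuity and sections $\Omega_{nx}$, and let $\Omega_x=\bigcup_n\Omega_{nx}$ (all as defined in the context). Then the double integral of $f$ over $\Omega$ can be written as the repeated integral $$\int_\Omega f(x,y)\,dx\,dy=\int_a^b\left(\int_{\Omega_x}f(x,y)\,dy\right)dx,$$ where the inner integral, with variable of integration $y$, is taken over $\Omega_x$ in the improper meaning $$\int_{\Omega_x}f(x,y)\,dy=\lim_{n\to\infty}\int_{\Omega_{nx}}f(x,y)\,dy,$$ and represents a (Riemann) integrable function of $x$ on $[a,b]$.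
   Context: Integrable means Riemann integrable (in particular bounded), and all integrals are Riemann integrals, the inner one in the improper meaning given in the claim. A closed Jordan domain is a bounded closed set in $\mathbb{R}^2$ with nonempty interior whose boundary has Jordan measure zero. A set has zero Jordan measure if for every $\varepsilon>0$ it can be covered by finitely many squares with sides parallel to the axes and total area less than $\varepsilon$. The function $f$ is regarded as extended by $0$ to the closed rectangle $\overline{\mathbf{R}}=[a,b]\times[c,d]$, and its points of discontinuity are those of the extended function. For each $\varepsilon=\varepsilon_n$, $\Delta_\varepsilon$ denotes the union of a finite family of open squares with sides parallel to the axes and with total area less than $\varepsilon$, no square of the family being contained in another one, whose union contains all points of discontinuity of $f$; the coverings are chosen nested, $\Delta_{\varepsilon_{n+1}}\subset\Delta_{\varepsilon_n}$. For $x\in[a,b]$, $$\Omega_{nx}=\Omega_{x,\varepsilon_n}=\{y\in[c,d]\mid (x,y)\notin\Delta_{\varepsilon_n}\},$$ which increases with $n$, and $\Omega_x=\bigcup_n\Omega_{nx}$. *)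

theory Defs
  imports "HOL-Analysis.Analysis"
begin

(* The Henstock-Kurzweil definition with the gauge restricted to be constant, i.e. the limit of
   Riemann sums as the mesh of the tagged partition tends to 0. *)
definition has_riemann_integral_cbox ::
    "('a::euclidean_space \<Rightarrow> real) \<Rightarrow> real \<Rightarrow> 'a \<Rightarrow> 'a \<Rightarrow> bool" where
  "has_riemann_integral_cbox f I u v \<longleftrightarrow>
     (\<forall>e>0. \<exists>\<delta>>0. \<forall>p. p tagged_division_of cbox u v \<and> (\<lambda>x. ball x \<delta>) fine p \<longrightarrow>
        \<bar>(\<Sum>(x, K)\<in>p. measure lborel K * f x) - I\<bar> < e)"

definition zero_ext :: "'a set \<Rightarrow> ('a \<Rightarrow> real) \<Rightarrow> 'a \<Rightarrow> real" where
  "zero_ext S f = (\<lambda>p. if p \<in> S then f p else 0)"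

(* Neither existence nor value of the integral of the extension by 0 depends on the choice of a
   nondegenerate box around S.  Quantifying over all boxes, rather than asking for some box, keeps
   unbounded functions on subsets of degenerate boxes from counting as integrable. *)
definition has_riemann_integral ::
    "('a::euclidean_space \<Rightarrow> real) \<Rightarrow> real \<Rightarrow> 'a set \<Rightarrow> bool" where
  "has_riemann_integral f I S \<longleftrightarrow>
     bounded S \<and> (\<forall>u v. S \<subseteq> cbox u v \<longrightarrow> has_riemann_integral_cbox (zero_ext S f) I u v)"

definition riemann_integrable :: "'a::euclidean_space set \<Rightarrow> ('a \<Rightarrow> real) \<Rightarrow> bool" where
  "riemann_integrable S f \<longleftrightarrow> (\<exists>I. has_riemann_integral f I S)"

definition riemann_integral :: "'a::euclidean_space set \<Rightarrow> ('a \<Rightarrow> real) \<Rightarrow> real" where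
  "riemann_integral S f = (THE I. has_riemann_integral f I S)"

lemma has_riemann_integral_cbox_imp_has_integral:
  assumes "has_riemann_integral_cbox f I u v"
  shows "(f has_integral I) (cbox u v)"
  unfolding has_integral
proof (intro allI impI)
  fix e :: real
  assume "e > 0"
  then obtain \<delta> where \<delta>: "\<delta> > 0"
    "\<And>p. p tagged_division_of cbox u v \<Longrightarrow> (\<lambda>x. ball x \<delta>) fine p \<Longrightarrow>
       \<bar>(\<Sum>(x, K)\<in>p. measure lborel K * f x) - I\<bar> < e"
    using assms unfolding has_riemann_integral_cbox_def by meson
  then show "\<exists>\<gamma>. gauge \<gamma> \<and> (\<forall>p. p tagged_division_of cbox u v \<and> \<gamma> fine p \<longrightarrow>
      norm ((\<Sum>(x, K)\<in>p. measure lborel K *\<^sub>R f x) - I) < e)"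
    by (intro exI[of _ "\<lambda>x. ball x \<delta>"]) (auto intro: gauge_ball)
qed

lemma has_riemann_integral_unique:
  assumes "has_riemann_integral f I S" "has_riemann_integral f J S"
  shows "I = J"
proof -
  obtain u v where "S \<subseteq> cbox u v"
    using assms(1) bounded_subset_cbox_symmetric unfolding has_riemann_integral_def by metis
  then show ?thesis
    using assms has_riemann_integral_cbox_imp_has_integral has_integral_unique
    unfolding has_riemann_integral_def by metis
qed

lemma riemann_integral_eq: "has_riemann_integral f I S \<Longrightarrow> riemann_integral S f = I"
  unfolding riemann_integral_def by (blast intro: has_riemann_integral_unique)

(* Improper integral over S along an increasing exhaustion A of S; the value is meaningful only
   under improper_riemann_integrable A S f. *)
definition improper_riemann_integrable ::
    "(nat \<Rightarrow> 'a::euclidean_space set) \<Rightarrow> 'a set \<Rightarrow> ('a \<Rightarrow> real) \<Rightarrow> bool" where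
  "improper_riemann_integrable A S f \<longleftrightarrow>
     incseq A \<and> (\<Union>n. A n) = S \<and> (\<forall>n. riemann_integrable (A n) f) \<and>
     convergent (\<lambda>n. riemann_integral (A n) f)"

definition improper_riemann_integral ::
    "(nat \<Rightarrow> 'a::euclidean_space set) \<Rightarrow> ('a \<Rightarrow> real) \<Rightarrow> real" where
  "improper_riemann_integral A f = lim (\<lambda>n. riemann_integral (A n) f)"

definition closed_square :: "(real \<times> real) set \<Rightarrow> bool" where
  "closed_square Q \<longleftrightarrow> (\<exists>u v s. s > 0 \<and> Q = {u..u + s} \<times> {v..v + s})"

definition open_square :: "(real \<times> real) set \<Rightarrow> bool" where
  "open_square Q \<longleftrightarrow> (\<exists>u v s. s > 0 \<and> Q = {u<..<u + s} \<times> {v<..<v + s})"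

definition jordan_null :: "(real \<times> real) set \<Rightarrow> bool" where
  "jordan_null S \<longleftrightarrow>
     (\<forall>e>0. \<exists>\<Q>. finite \<Q> \<and> (\<forall>Q\<in>\<Q>. closed_square Q) \<and> S \<subseteq> \<Union>\<Q> \<and>
        (\<Sum>Q\<in>\<Q>. measure lborel Q) < e)"

definition closed_jordan_domain :: "(real \<times> real) set \<Rightarrow> bool" where
  "closed_jordan_domain S \<longleftrightarrow>
     bounded S \<and> closed S \<and> interior S \<noteq> {} \<and> jordan_null (frontier S)"

definition discontinuities ::
    "'a::t2_space set \<Rightarrow> ('a \<Rightarrow> 'b::topological_space) \<Rightarrow> 'a set" where
  "discontinuities B g = {p \<in> B. \<not> continuous (at p within B) g}"

definition square_covering :: "(real \<times> real) set \<Rightarrow> real \<Rightarrow> (real \<times> real) set set \<Rightarrow> bool" where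
  "square_covering D e \<Q> \<longleftrightarrow>
     finite \<Q> \<and> (\<forall>Q\<in>\<Q>. open_square Q) \<and> (\<Sum>Q\<in>\<Q>. measure lborel Q) < e \<and>
     (\<forall>P\<in>\<Q>. \<forall>Q\<in>\<Q>. P \<subseteq> Q \<longrightarrow> P = Q) \<and> D \<subseteq> \<Union>\<Q>"

definition omitted_section :: "real \<Rightarrow> real \<Rightarrow> (real \<times> real) set \<Rightarrow> real \<Rightarrow> real set" where
  "omitted_section c d \<Delta> x = {y \<in> {c..d}. (x, y) \<notin> \<Delta>}"

end

theory Submission
  imports Defs
begin

text \<open>
  Let \<open>N\<close> be the intersection of the coverings; it has measure zero. The function
  \<open>H\<close> that agrees with \<open>g\<close> on the rectangle off \<open>N\<close> and vanishes elsewhere is Borel,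
  being the pointwise limit of the restrictions of \<open>g\<close> to the closed sets left by the coverings.
  By dominated convergence the improper inner integral is the Lebesgue integral \<open>F x\<close> of \<open>H (x, _)\<close>,
  and Fubini gives the value of the repeated integral. Riemann integrability of \<open>F\<close> follows from
  Lebesgue's criterion: enlarge \<open>N\<close> by the boundaries of all coverings to a null set \<open>N'\<close>. If the
  section of \<open>N'\<close> at \<open>x\<close> is null, then \<open>H (z, y)\<close> tends to \<open>H (x, y)\<close> as \<open>z\<close> tends to \<open>x\<close>, for almost
  every \<open>y\<close>, so \<open>F\<close> is continuous at \<open>x\<close>.
\<close>

section \<open>Riemann integrability, boundedness and negligible discontinuities\<close>

text \<open>Boundedness comes from the mesh bound being uniform; a general gauge would not give it.
  On a box of measure zero every Riemann sum vanishes, so there any function, bounded or not, has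
  integral 0; \<open>content\<close> excludes this case.\<close>

lemma has_riemann_integral_cbox_imp_bounded:
  fixes f :: "'a::euclidean_space \<Rightarrow> real"
  assumes f: "has_riemann_integral_cbox f I u v"
    and content: "measure lborel (cbox u v) \<noteq> 0"
  shows "bounded (f ` cbox u v)"
proof -
  obtain \<delta> where "\<delta> > 0" and \<delta>: "\<And>p. p tagged_division_of cbox u v \<Longrightarrow> (\<lambda>x. ball x \<delta>) fine p \<Longrightarrow>
       \<bar>(\<Sum>(x, K)\<in>p. measure lborel K * f x) - I\<bar> < 1"
    using f unfolding has_riemann_integral_cbox_def by (meson zero_less_one)
  \<comment> \<open>With half the radius, a cell lies within \<open>\<delta>\<close> of each of its
    own points, so its tag can be moved anywhere in the cell without losing fineness.\<close>
  have "gauge (\<lambda>x::'a. ball x (\<delta>/2))"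
    using \<open>\<delta> > 0\<close> by (intro gauge_ball) auto
  then obtain p where p: "p tagged_division_of cbox u v" "(\<lambda>x. ball x (\<delta>/2)) fine p"
    using fine_division_exists by blast
  define D where "D = {K \<in> snd ` p. measure lborel K \<noteq> 0}"
  have D: "D division_of cbox u v"
    unfolding D_def using content division_of_nontrivial[OF division_of_tagged_division[OF p(1)]]
    by blast
  have "finite D" using D by auto
  have small: "K \<subseteq> ball y \<delta>" if "K \<in> D" "y \<in> K" for K y
  proof -
    obtain x where "(x, K) \<in> p" using \<open>K \<in> D\<close> by (auto simp: D_def)
    then have K: "K \<subseteq> ball x (\<delta>/2)" using p(2) by (auto simp: fine_def)
    show ?thesis
    proof
      fix z assume "z \<in> K"
      then have "dist x z < \<delta>/2" "dist x y < \<delta>/2" using K \<open>y \<in> K\<close> by auto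
      then show "z \<in> ball y \<delta>" using dist_triangle_half_r by (auto simp: dist_commute)
    qed
  qed
  \<comment> \<open>Only cells of positive measure are kept, so all sums with tags in \<open>D\<close> staying within 1 of \<open>I\<close>
    bounds the oscillation of \<open>f\<close> on each cell: change a single tag.\<close>
  have tagging: "\<bar>(\<Sum>K\<in>D. measure lborel K * f (t K)) - I\<bar> < 1" if t: "\<And>K. K \<in> D \<Longrightarrow> t K \<in> K" for t
  proof -
    let ?q = "(\<lambda>K. (t K, K)) ` D"
    have "?q tagged_division_of cbox u v"
    proof (rule tagged_division_ofI)
      show "finite ?q" using \<open>finite D\<close> by simp
      show "\<Union>{K. \<exists>x. (x, K) \<in> ?q} = cbox u v"
        using division_ofD(6)[OF D] by (auto simp: image_iff)
      fix x1 K1 assume "(x1, K1) \<in> ?q"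
      then have K1: "K1 \<in> D" "x1 = t K1" by auto
      show "x1 \<in> K1" using K1 t by simp
      show "K1 \<subseteq> cbox u v" using K1 division_ofD(2)[OF D] by blast
      show "\<exists>a b. K1 = cbox a b" using K1 division_ofD(4)[OF D] by blast
      fix x2 K2 assume "(x2, K2) \<in> ?q" "(x1, K1) \<noteq> (x2, K2)"
      then have "K2 \<in> D" "K1 \<noteq> K2" using K1 by auto
      then show "interior K1 \<inter> interior K2 = {}"
        using division_ofD(5)[OF D] K1 by blast
    qed
    moreover have "(\<lambda>x. ball x \<delta>) fine ?q"
      unfolding fine_def using small t by blast
    moreover have "(\<Sum>(x, K)\<in>?q. measure lborel K * f x) = (\<Sum>K\<in>D. measure lborel K * f (t K))"
      by (subst sum.reindex) (simp_all add: inj_on_def)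
    ultimately show ?thesis using \<delta>[of ?q] by simp
  qed
  have "bounded (f ` K)" if "K \<in> D" for K
  proof -
    define s where "s L = (SOME x::'a. x \<in> L)" for L
    have s: "s L \<in> L" if "L \<in> D" for L
      using division_ofD(3)[OF D that] by (simp add: s_def some_in_eq)
    have pos: "measure lborel K > 0"
      using that by (simp add: D_def zero_less_measure_iff)
    \<comment> \<open>The taggings \<open>s\<close> and \<open>s(K := y)\<close> give sums that
      differ only in the term of \<open>K\<close>. Both lie within 1 of \<open>I\<close>, whence the
      constant 2.\<close>
    have "\<bar>f y\<bar> \<le> \<bar>f (s K)\<bar> + 2 / measure lborel K" if "y \<in> K" for y
    proof -
      have "\<bar>(\<Sum>L\<in>D. measure lborel L * f ((s(K := y)) L)) - I\<bar> < 1"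
        using s that by (intro tagging) auto
      moreover have "\<bar>(\<Sum>L\<in>D. measure lborel L * f (s L)) - I\<bar> < 1"
        using s by (intro tagging) auto
      moreover have "(\<Sum>L\<in>D. measure lborel L * f ((s(K := y)) L)) - (\<Sum>L\<in>D. measure lborel L * f (s L))
          = measure lborel K * (f y - f (s K))"
      proof -
        have "(\<Sum>L\<in>D. measure lborel L * f ((s(K := y)) L)) - (\<Sum>L\<in>D. measure lborel L * f (s L))
            = (\<Sum>L\<in>D. if L = K then measure lborel K * (f y - f (s K)) else 0)"
          unfolding sum_subtractf[symmetric] by (intro sum.cong) (simp_all add: right_diff_distrib)
        then show ?thesis using \<open>finite D\<close> \<open>K \<in> D\<close> by simp
      qed
      ultimately have "\<bar>measure lborel K * (f y - f (s K))\<bar> < 2" by linarith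
      then have "\<bar>f y - f (s K)\<bar> < 2 / measure lborel K"
        using pos by (simp add: abs_mult pos_less_divide_eq mult.commute)
      then show ?thesis by linarith
    qed
    then show ?thesis by (auto simp: bounded_iff)
  qed
  then have "bounded (\<Union>K\<in>D. f ` K)"
    using \<open>finite D\<close> by (intro bounded_UN) auto
  then show ?thesis
    using division_ofD(6)[OF D] by (metis image_Union)
qed

text \<open>The sufficient half of Lebesgue's criterion. It also identifies the Riemann integral
  with the gauge integral, so that the convergence theorems for the latter can be used.\<close>

lemma has_riemann_integral_cbox_negligible_discontinuities:
  fixes f :: "'a::euclidean_space \<Rightarrow> real"
  assumes bdd: "bounded (f ` cbox u v)"
    and disc: "negligible (discontinuities (cbox u v) f)"
  shows "has_riemann_integral_cbox f (integral (cbox u v) f) u v"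
proof (rule ccontr)
  \<comment> \<open>Read as integrals of step functions \<open>\<phi> n\<close>, Riemann sums of vanishing mesh converge by
    dominated convergence, since \<open>\<phi> n x\<close> tends to \<open>f x\<close> wherever \<open>f\<close> is continuous.\<close>
  assume "\<not> ?thesis"
  then obtain e where "e > 0" and
    bad: "\<And>\<delta>. \<delta> > 0 \<Longrightarrow> \<exists>p. p tagged_division_of cbox u v \<and> (\<lambda>x. ball x \<delta>) fine p \<and>
        \<bar>(\<Sum>(x, K)\<in>p. measure lborel K * f x) - integral (cbox u v) f\<bar> \<ge> e"
    unfolding has_riemann_integral_cbox_def by (meson not_le)
  define r where "r n = inverse (real (Suc n))" for n
  have "\<forall>n. \<exists>p. p tagged_division_of cbox u v \<and> (\<lambda>x. ball x (r n)) fine p \<and>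
        \<bar>(\<Sum>(x, K)\<in>p. measure lborel K * f x) - integral (cbox u v) f\<bar> \<ge> e"
    using bad by (simp add: r_def)
  then obtain p where p: "\<And>n. p n tagged_division_of cbox u v"
    and fine: "\<And>n. (\<lambda>x. ball x (r n)) fine p n"
    and far: "\<And>n. \<bar>(\<Sum>(x, K)\<in>p n. measure lborel K * f x) - integral (cbox u v) f\<bar> \<ge> e"
    by metis
  obtain B where B: "\<And>x. x \<in> cbox u v \<Longrightarrow> \<bar>f x\<bar> \<le> B"
    using bdd by (auto simp: bounded_iff)
  \<comment> \<open>On a face shared by several cells \<open>\<phi> n\<close> adds up several tag
    values. All such faces go into the negligible set \<open>N\<close>.\<close>
  define \<phi> where "\<phi> n x = (\<Sum>(t, K)\<in>p n. if x \<in> K then f t else 0)" for n x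
  define N where "N = discontinuities (cbox u v) f \<union> (\<Union>n. \<Union>(t, K)\<in>p n. frontier K)"
  have "negligible (frontier K)" if "(t, K) \<in> p n" for t K n
    using tagged_division_ofD(4)[OF p that] by (auto intro!: negligible_convex_frontier)
  then have "negligible N"
    unfolding N_def using disc tagged_division_ofD(1)[OF p]
    by (intro negligible_Un negligible_Union_nat negligible_Union finite_imageI) auto
  have int_\<phi>: "(\<phi> n has_integral (\<Sum>(t, K)\<in>p n. measure lborel K * f t)) (cbox u v)" for n
    unfolding \<phi>_def
  proof (rule has_integral_sum)
    show "finite (p n)" using p by auto
    fix q assume "q \<in> p n"
    then obtain t K where q: "q = (t, K)" "(t, K) \<in> p n" by (cases q) auto
    then obtain y z where "K = cbox y z" "K \<subseteq> cbox u v"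
      using tagged_division_ofD(3,4)[OF p q(2)] by auto
    moreover have "((\<lambda>x. f t) has_integral measure lborel (cbox y z) *\<^sub>R f t) (cbox y z)"
      by (rule has_integral_const)
    ultimately show "((\<lambda>x. case q of (t, K) \<Rightarrow> if x \<in> K then f t else 0) has_integral
        (case q of (t, K) \<Rightarrow> measure lborel K * f t)) (cbox u v)"
      using q by (simp add: has_integral_restrict)
  qed
  have \<phi>_eq: "\<exists>t \<in> cbox u v. \<phi> n x = f t \<and> dist t x < r n" if x: "x \<in> cbox u v - N" for n x
  proof -
    obtain t K where tK: "(t, K) \<in> p n" "x \<in> K"
      using tagged_division_ofD(6)[OF p[of n]] x by blast
    \<comment> \<open>Off \<open>N\<close> a point is interior to every cell containing it. Since
      interiors of different cells are disjoint, exactly one term of the sum survives.\<close>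
    have int: "x \<in> interior L" if "(s, L) \<in> p n" "x \<in> L" for s L
      using that x closure_subset unfolding N_def frontier_def by blast
    have "(if x \<in> snd q then f (fst q) else 0) = 0" if "q \<in> p n - {(t, K)}" for q
      using that int tK tagged_division_ofD(5)[OF p[of n] tK(1), of "fst q" "snd q"] int[OF tK]
      by (cases q) auto
    then have "(\<Sum>q\<in>p n - {(t, K)}. if x \<in> snd q then f (fst q) else 0) = 0"
      by (intro sum.neutral) blast
    then have "\<phi> n x = f t"
      unfolding \<phi>_def using tK tagged_division_ofD(1)[OF p[of n]]
      by (subst sum.remove[of _ "(t, K)"]) (auto simp: case_prod_beta)
    moreover have "K \<subseteq> ball t (r n)" using fine[of n] tK by (auto simp: fine_def)
    moreover have "t \<in> cbox u v" using tagged_division_ofD(2,3)[OF p[of n] tK(1)] by auto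
    ultimately show ?thesis using tK by (intro bexI[of _ t]) auto
  qed
  have "(\<lambda>n. integral (cbox u v - N) (\<phi> n)) \<longlonglongrightarrow> integral (cbox u v - N) f"
  proof (rule dominated_convergence)
    have spike: "negligible (cbox u v - (cbox u v - N))" "negligible ((cbox u v - N) - cbox u v)"
      using \<open>negligible N\<close> by (auto intro: negligible_subset)
    fix n
    show "\<phi> n integrable_on cbox u v - N"
      using integrable_spike_set[OF has_integral_integrable[OF int_\<phi>]] spike
      by (metis (mono_tags, lifting) mem_Collect_eq negligible_subset subsetI)
    show "(\<lambda>x. B) integrable_on cbox u v - N"
      using integrable_spike_set[OF integrable_const] spike
      by (metis (mono_tags, lifting) mem_Collect_eq negligible_subset subsetI)
    show "norm (\<phi> n x) \<le> B" if "x \<in> cbox u v - N" for x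
      using \<phi>_eq[OF that, of n] B by auto
  next
    fix x assume x: "x \<in> cbox u v - N"
    obtain \<tau> where \<tau>: "\<And>n. \<tau> n \<in> cbox u v" "\<And>n. \<phi> n x = f (\<tau> n)" "\<And>n. dist (\<tau> n) x < r n"
      using \<phi>_eq[OF x] by metis
    have "r \<longlonglongrightarrow> 0" unfolding r_def by (rule LIMSEQ_inverse_real_of_nat)
    then have "\<tau> \<longlonglongrightarrow> x"
      by (rule metric_tendsto_imp_tendsto) (use \<tau>(3) in \<open>auto intro!: eventuallyI less_imp_le simp: r_def\<close>)
    moreover have "continuous (at x within cbox u v) f"
      using x by (auto simp: N_def discontinuities_def)
    ultimately have "(f \<circ> \<tau>) \<longlonglongrightarrow> f x"
      using \<tau>(1) unfolding continuous_within_sequentially by blast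
    then show "(\<lambda>n. \<phi> n x) \<longlonglongrightarrow> f x"
      using \<tau>(2) by (simp add: o_def)
  qed
  moreover have "integral (cbox u v - N) h = integral (cbox u v) h" for h :: "'a \<Rightarrow> real"
    by (rule integral_spike_set) (use \<open>negligible N\<close> in \<open>auto intro: negligible_subset\<close>)
  ultimately have "(\<lambda>n. \<Sum>(t, K)\<in>p n. measure lborel K * f t) \<longlonglongrightarrow> integral (cbox u v) f"
    using integral_unique[OF int_\<phi>] by simp
  then obtain n where "\<bar>(\<Sum>(t, K)\<in>p n. measure lborel K * f t) - integral (cbox u v) f\<bar> < e"
    using \<open>e > 0\<close> unfolding lim_sequentially dist_real_def by blast
  then show False using far[of n] by simp
qed

text \<open>Extension by 0 creates new discontinuities only on the frontier of \<open>S\<close>: it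
  is locally equal to \<open>f\<close> on the interior and locally 0 off the closure.\<close>

lemma has_riemann_integral_negligible_discontinuities:
  fixes f :: "'a::euclidean_space \<Rightarrow> real"
  assumes "bounded S" "bounded (f ` S)"
    and disc: "negligible (discontinuities S f)"
    and frontier: "negligible (frontier S)"
  shows "has_riemann_integral f (integral S f) S"
  unfolding has_riemann_integral_def
proof (intro conjI allI impI)
  fix u v assume S: "S \<subseteq> cbox u v"
  have "zero_ext S f ` cbox u v \<subseteq> insert 0 (f ` S)"
    by (auto simp: zero_ext_def)
  then have "bounded (zero_ext S f ` cbox u v)"
    using assms(2) by (meson bounded_insert bounded_subset)
  moreover have "discontinuities (cbox u v) (zero_ext S f) \<subseteq> discontinuities S f \<union> frontier S"
  proof
    fix x assume x: "x \<in> discontinuities (cbox u v) (zero_ext S f)"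
    show "x \<in> discontinuities S f \<union> frontier S"
    proof (rule ccontr)
      assume not: "x \<notin> discontinuities S f \<union> frontier S"
      then consider "x \<in> interior S" | "x \<in> - closure S"
        by (auto simp: frontier_def)
      then have "isCont (zero_ext S f) x"
      proof cases
        case 1
        then have "continuous (at x within S) f"
          using not interior_subset by (auto simp: discontinuities_def)
        then have "isCont f x"
          using 1 by (metis at_within_interior)
        moreover have "\<forall>\<^sub>F y in nhds x. zero_ext S f y = f y"
          using 1 interior_subset by (auto simp: eventually_nhds zero_ext_def intro!: exI[of _ "interior S"])
        ultimately show ?thesis by (simp add: isCont_cong)
      next
        case 2
        then have "\<forall>\<^sub>F y in nhds x. zero_ext S f y = 0"
          using closure_subset by (auto simp: eventually_nhds zero_ext_def intro!: exI[of _ "- closure S"])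
        then show ?thesis by (simp add: isCont_cong)
      qed
      then show False
        using x continuous_at_imp_continuous_at_within by (auto simp: discontinuities_def)
    qed
  qed
  then have "negligible (discontinuities (cbox u v) (zero_ext S f))"
    using disc frontier by (meson negligible_Un negligible_subset)
  moreover have "integral (cbox u v) (zero_ext S f) = integral S f"
    using S by (simp add: zero_ext_def integral_restrict_Int inf.absorb1)
  ultimately show "has_riemann_integral_cbox (zero_ext S f) (integral S f) u v"
    using has_riemann_integral_cbox_negligible_discontinuities by metis
qed (fact assms)

section \<open>Negligible sets arising from square coverings\<close>

lemma negligible_frontier_Union_convex:
  fixes \<F> :: "'a::euclidean_space set set"
  assumes "finite \<F>" "\<And>S. S \<in> \<F> \<Longrightarrow> convex S"
  shows "negligible (frontier (\<Union>\<F>))"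
proof -
  have "negligible (\<Union>S\<in>\<F>. frontier S)"
    using assms by (intro negligible_Union) (auto intro: negligible_convex_frontier)
  then show ?thesis
    using frontier_Union_subset[OF assms(1)] negligible_subset by blast
qed

lemma open_square_imp:
  assumes "open_square Q"
  shows "open Q" "convex Q" "bounded Q" "convex {y. (x, y) \<in> Q}"
proof -
  obtain u v s where Q: "Q = {u<..<u + s} \<times> {v<..<v + s}"
    using assms by (auto simp: open_square_def)
  show "open Q" "convex Q" "bounded Q"
    unfolding Q using bounded_box[of u "u + s"] bounded_box[of v "v + s"]
    by (auto intro!: open_Times convex_Times bounded_Times)
  have "{y. (x, y) \<in> Q} = (if x \<in> {u<..<u + s} then {v<..<v + s} else {})"
    by (auto simp: Q)
  then show "convex {y. (x, y) \<in> Q}" by simp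
qed

text \<open>The section is an interval with finitely many intervals removed. This makes it an
  admissible domain for the inner Riemann integral.\<close>

lemma negligible_frontier_omitted_section:
  assumes "finite \<Q>" "\<And>Q. Q \<in> \<Q> \<Longrightarrow> open_square Q"
  shows "negligible (frontier (omitted_section c d (\<Union>\<Q>) x))"
proof -
  let ?S = "(\<lambda>Q. {y. (x, y) \<in> Q}) ` \<Q>"
  have "omitted_section c d (\<Union>\<Q>) x = {c..d} \<inter> - \<Union>?S"
    by (auto simp: omitted_section_def)
  then have "frontier (omitted_section c d (\<Union>\<Q>) x) \<subseteq> frontier {c..d} \<union> frontier (\<Union>?S)"
    using frontier_Int_subset[of "{c..d}" "- \<Union>?S"] by (simp only: frontier_complement)
  moreover have "negligible (frontier (\<Union>?S))"
    using assms open_square_imp(4) by (intro negligible_frontier_Union_convex) auto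
  moreover have "negligible (frontier {c..d})"
    by (intro negligible_convex_frontier) simp
  ultimately show ?thesis
    by (meson negligible_Un negligible_subset)
qed

text \<open>The intersection lies in each covering, and the measure of the \<open>n\<close>-th one
  is at most its total area, hence below \<open>\<epsilon> n\<close>.\<close>

lemma negligible_Inter_square_coverings:
  assumes \<epsilon>: "\<epsilon> \<longlonglongrightarrow> 0" and cov: "\<And>n::nat. square_covering D (\<epsilon> n) (\<Q> n)"
  shows "negligible (\<Inter>n. \<Union>(\<Q> n))"
  unfolding negligible_outer
proof (intro allI impI)
  fix e :: real assume "e > 0"
  then have "\<forall>\<^sub>F n in sequentially. \<epsilon> n < e"
    using \<epsilon> by (intro order_tendstoD(2)[of \<epsilon> 0])
  then obtain n where n: "\<epsilon> n < e"
    using eventually_happens trivial_limit_sequentially by blast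
  have Q: "finite (\<Q> n)" "\<And>Q. Q \<in> \<Q> n \<Longrightarrow> open_square Q"
    "(\<Sum>Q\<in>\<Q> n. measure lborel Q) < \<epsilon> n"
    using cov[of n] by (auto simp: square_covering_def)
  have "bounded (\<Union>(\<Q> n))" "open (\<Union>(\<Q> n))"
    using Q open_square_imp by (auto intro!: bounded_Union)
  moreover have "measure lborel (\<Union>(\<Q> n)) \<le> (\<Sum>Q\<in>\<Q> n. measure lborel Q)"
    using Q open_square_imp by (intro measure_Union_le) auto
  ultimately show "\<exists>T. (\<Inter>n. \<Union>(\<Q> n)) \<subseteq> T \<and> T \<in> lmeasurable \<and> measure lebesgue T < e"
    using Q(3) n by (intro exI[of _ "\<Union>(\<Q> n)"]) (auto intro: lmeasurable_open)
qed

text \<open>Fubini for a null set. Being Borel, \<open>N\<close> is null for \<open>lborel\<close>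
  itself and not only for its completion, so the product measure argument applies.\<close>

lemma negligible_AE_section:
  fixes N :: "(real \<times> real) set"
  assumes "negligible N" "N \<in> sets borel"
  shows "negligible {x. \<not> (AE y in lborel. (x, y) \<notin> N)}"
proof -
  have "N \<in> null_sets lborel"
    using assms by (simp add: negligible_iff_null_sets null_sets_completion_iff)
  then have "AE p in lborel \<Otimes>\<^sub>M lborel. p \<notin> N"
    unfolding lborel_prod by (rule AE_not_in)
  then have "AE x in lborel. AE y in lborel. (x, y) \<notin> N"
    by (rule lborel_pair.AE_pair)
  then obtain N' where "{x. \<not> (AE y in lborel. (x, y) \<notin> N)} \<subseteq> N'" "N' \<in> null_sets lborel"
    by (auto elim!: AE_E simp: null_sets_def)
  then show ?thesis
    by (meson negligible_iff_null_sets negligible_subset null_sets_completionI)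
qed

theorem theorem4:
  fixes a b c d :: real
    and \<Omega> :: "(real \<times> real) set"
    and f g :: "real \<times> real \<Rightarrow> real"
    and \<epsilon> :: "nat \<Rightarrow> real"
    and \<Q> :: "nat \<Rightarrow> (real \<times> real) set set"
    and \<Delta> :: "nat \<Rightarrow> (real \<times> real) set"
    and \<Omega>n :: "real \<Rightarrow> nat \<Rightarrow> real set"
    and \<Omega>x :: "real \<Rightarrow> real set"
  defines "g \<equiv> zero_ext \<Omega> f"
    and "\<Delta> \<equiv> \<lambda>n. \<Union>(\<Q> n)"
    and "\<Omega>n \<equiv> \<lambda>x n. omitted_section c d (\<Delta> n) x"
    and "\<Omega>x \<equiv> \<lambda>x. \<Union>n. \<Omega>n x n"
  assumes "closed_jordan_domain \<Omega>"
    and "\<Omega> \<subseteq> {a<..<b} \<times> {c<..<d}"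
    and "riemann_integrable \<Omega> f"
    and "jordan_null (discontinuities ({a..b} \<times> {c..d}) g)"
    and "\<And>n. \<epsilon> n > 0"
    and "\<And>n. \<epsilon> (Suc n) < \<epsilon> n"
    and "\<epsilon> \<longlonglongrightarrow> 0"
    and "\<And>n. square_covering (discontinuities ({a..b} \<times> {c..d}) g) (\<epsilon> n) (\<Q> n)"
    and "\<And>n. \<Delta> (Suc n) \<subseteq> \<Delta> n"
  shows "(\<forall>x\<in>{a..b}. improper_riemann_integrable (\<Omega>n x) (\<Omega>x x) (\<lambda>y. g (x, y))) \<and>
    riemann_integrable {a..b} (\<lambda>x. improper_riemann_integral (\<Omega>n x) (\<lambda>y. g (x, y))) \<and>
    riemann_integral \<Omega> f =
      riemann_integral {a..b} (\<lambda>x. improper_riemann_integral (\<Omega>n x) (\<lambda>y. g (x, y)))"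
proof -

  \<comment> \<open>The rectangle and the bounded extension \<open>g\<close>\<close>
  define R where "R = {a..b} \<times> {c..d}"
  have R: "R = cbox (a, c) (b, d)"
    by (simp add: R_def cbox_Pair_eq)
  \<comment> \<open>A nonempty subset of the open rectangle forces \<open>a < b\<close> and
    \<open>c < d\<close>, so \<open>R\<close> has positive area and integrability of
    \<open>g\<close> implies its boundedness.\<close>
  have "\<Omega> \<noteq> {}"
    using assms(5) by (auto simp: closed_jordan_domain_def)
  then have "a < b" "c < d" "\<Omega> \<subseteq> R"
    using assms(6) by (force simp: R_def)+
  obtain I where I: "has_riemann_integral f I \<Omega>"
    using assms(7) by (auto simp: riemann_integrable_def)
  then have g: "has_riemann_integral_cbox g I (a, c) (b, d)"
    using \<open>\<Omega> \<subseteq> R\<close> by (simp add: has_riemann_integral_def g_def R)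
  have "bounded (g ` R)"
    unfolding R using g \<open>a < b\<close> \<open>c < d\<close>
    by (intro has_riemann_integral_cbox_imp_bounded) (auto simp: content_Pair)
  then obtain B where B_R: "\<And>p. p \<in> R \<Longrightarrow> \<bar>g p\<bar> \<le> B"
    by (auto simp: bounded_iff)
  have sq: "finite (\<Q> n)" "\<And>Q. Q \<in> \<Q> n \<Longrightarrow> open_square Q" and
    disc: "discontinuities R g \<subseteq> \<Delta> n" for n
    using assms(12)[of n] by (auto simp: square_covering_def \<Delta>_def R_def)
  have "open (\<Delta> n)" for n
    using sq open_square_imp(1) by (auto simp: \<Delta>_def)
  have "decseq \<Delta>"
    using assms(13) by (rule decseq_SucI)
  have g_cont: "continuous (at p within R) g" if "p \<in> R - \<Delta> n" for p n
    using that disc by (auto simp: discontinuities_def)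
  define N where "N = (\<Inter>n. \<Delta> n)"
  have "negligible N"
    unfolding N_def \<Delta>_def by (rule negligible_Inter_square_coverings) (fact assms)+
  have [measurable]: "N \<in> sets borel" "R \<in> sets borel" "\<Delta> n \<in> sets borel" for n
    using \<open>\<And>n. open (\<Delta> n)\<close> by (auto simp: N_def R)

  \<comment> \<open>Borel functions obtained by cutting off the coverings\<close>
  define Hn where "Hn n p = indicator (R - \<Delta> n) p *\<^sub>R g p" for n p
  define H where "H p = indicator (R - N) p *\<^sub>R g p" for p
  have [measurable]: "Hn n \<in> borel_measurable borel" for n
    unfolding Hn_def
  proof (rule borel_measurable_continuous_on_indicator)
    show "continuous_on (R - \<Delta> n) g"
      using g_cont by (meson Diff_subset continuous_on_eq_continuous_within continuous_within_subset)
  qed simp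
  \<comment> \<open>The sequence is eventually constant: on \<open>N\<close> every term is 0, and a
    point missed by one covering is missed by all later ones because they are nested.\<close>
  have Hn_lim: "(\<lambda>n. Hn n p) \<longlonglongrightarrow> H p" for p
  proof (cases "p \<in> N")
    case True
    then show ?thesis by (simp add: Hn_def H_def N_def)
  next
    case False
    then obtain m where "p \<notin> \<Delta> m" by (auto simp: N_def)
    then have "p \<notin> \<Delta> n" if "n \<ge> m" for n
      using decseqD[OF \<open>decseq \<Delta>\<close> that] by blast
    then have "\<forall>\<^sub>F n in sequentially. Hn n p = H p"
      using False by (auto simp: Hn_def H_def indicator_def eventually_sequentially)
    then show ?thesis by (rule tendsto_eventually)
  qed
  have [measurable]: "H \<in> borel_measurable borel"
    using Hn_lim by (rule borel_measurable_LIMSEQ_metric[rotated]) simp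
  have H_bound: "norm (H p) \<le> B * indicator R p" "norm (Hn n p) \<le> B * indicator R p" for p n
    using B_R[of p] by (auto simp: H_def Hn_def indicator_def)
  have section_bound: "norm (H (x, y)) \<le> B * indicator {c..d} y"
    "norm (Hn n (x, y)) \<le> B * indicator {c..d} y" if "x \<in> {a..b}" for x y n
    using H_bound(1)[of "(x, y)"] H_bound(2)[of _ "(x, y)"] that by (auto simp: R_def indicator_def)
  have int_bound: "integrable lborel (\<lambda>y. B * indicator {c..d} y)"
    using \<open>c < d\<close> by simp
  have section_meas [measurable]: "(\<lambda>y. H (x, y)) \<in> borel_measurable borel"
     "(\<lambda>y. Hn n (x, y)) \<in> borel_measurable borel" for x n
    using measurable_compose[of "Pair x" borel borel H borel]
      measurable_compose[of "Pair x" borel borel "Hn n" borel]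
    by (simp_all add: borel_measurable_continuous_onI continuous_on_Pair)

  \<comment> \<open>The improper inner integral\<close>
  define F where "F x = (\<integral>y. H (x, y) \<partial>lborel)" for x
  \<comment> \<open>On the remaining section \<open>g (x, _)\<close> is bounded and continuous, and
    the section has a negligible frontier. Extended by 0 it is \<open>Hn n (x, _)\<close>, which
    turns the Riemann integral into a Lebesgue integral over the line.\<close>
  have slice: "has_riemann_integral (\<lambda>y. g (x, y)) (\<integral>y. Hn n (x, y) \<partial>lborel) (\<Omega>n x n)"
    if x: "x \<in> {a..b}" for x n
  proof -
    have sub: "y \<in> \<Omega>n x n \<longleftrightarrow> (x, y) \<in> R - \<Delta> n" for y
      using x by (auto simp: \<Omega>n_def omitted_section_def R_def)
    have "continuous (at y within \<Omega>n x n) (\<lambda>y. g (x, y))" if "y \<in> \<Omega>n x n" for y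
    proof (rule continuous_within_compose2[where g = g])
      show "continuous (at y within \<Omega>n x n) (Pair x)"
        by (intro continuous_intros)
      show "continuous (at (x, y) within Pair x ` \<Omega>n x n) g"
        using g_cont[of "(x, y)" n] that sub by (auto intro: continuous_within_subset)
    qed
    then have "discontinuities (\<Omega>n x n) (\<lambda>y. g (x, y)) = {}"
      by (auto simp: discontinuities_def)
    moreover have "bounded (\<Omega>n x n)"
      by (rule bounded_subset[of "{c..d}"]) (auto simp: \<Omega>n_def omitted_section_def)
    moreover have "bounded ((\<lambda>y. g (x, y)) ` \<Omega>n x n)"
      using B_R sub by (auto simp: bounded_iff)
    moreover have "negligible (frontier (\<Omega>n x n))"
      unfolding \<Omega>n_def \<Delta>_def using sq by (rule negligible_frontier_omitted_section)
    ultimately have "has_riemann_integral (\<lambda>y. g (x, y)) (integral (\<Omega>n x n) (\<lambda>y. g (x, y))) (\<Omega>n x n)"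
      by (intro has_riemann_integral_negligible_discontinuities) auto
    moreover have "(\<lambda>y. if y \<in> \<Omega>n x n then g (x, y) else 0) = (\<lambda>y. Hn n (x, y))"
      using sub by (auto simp: Hn_def)
    then have "integral (\<Omega>n x n) (\<lambda>y. g (x, y)) = integral UNIV (\<lambda>y. Hn n (x, y))"
      by (metis integral_restrict_UNIV)
    moreover have "integrable lborel (\<lambda>y. Hn n (x, y))"
      by (rule Bochner_Integration.integrable_bound[OF int_bound])
        (use section_bound(2)[OF x] in \<open>auto intro!: AE_I2 intro: order_trans[OF _ abs_ge_self]\<close>)
    ultimately show ?thesis
      by (simp add: integral_lborel)
  qed
  have lim_section: "(\<lambda>n. riemann_integral (\<Omega>n x n) (\<lambda>y. g (x, y))) \<longlonglongrightarrow> F x"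
    if x: "x \<in> {a..b}" for x
    unfolding riemann_integral_eq[OF slice[OF x]] F_def
    by (rule integral_dominated_convergence[where w = "\<lambda>y. B * indicator {c..d} y"])
      (use int_bound Hn_lim section_bound[OF x] in auto)
  have improper: "improper_riemann_integral (\<Omega>n x) (\<lambda>y. g (x, y)) = F x" if "x \<in> {a..b}" for x
    unfolding improper_riemann_integral_def using lim_section[OF that] by (rule limI)
  have "improper_riemann_integrable (\<Omega>n x) (\<Omega>x x) (\<lambda>y. g (x, y))" if "x \<in> {a..b}" for x
    unfolding improper_riemann_integrable_def
  proof (intro conjI allI)
    show "incseq (\<Omega>n x)"
      using assms(13) by (intro incseq_SucI) (auto simp: \<Omega>n_def omitted_section_def)
    show "riemann_integrable (\<Omega>n x n) (\<lambda>y. g (x, y))" for n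
      using slice[OF that] by (auto simp: riemann_integrable_def)
    show "convergent (\<lambda>n. riemann_integral (\<Omega>n x n) (\<lambda>y. g (x, y)))"
      using lim_section[OF that] by (rule convergentI)
  qed (simp add: \<Omega>x_def)

  \<comment> \<open>Almost everywhere continuity and Riemann integrability of
    \<open>F\<close>\<close>
  define N' where "N' = N \<union> (\<Union>n. frontier (\<Delta> n))"
  have "negligible N'"
    unfolding N'_def
  proof (intro negligible_Un negligible_Union_nat)
    show "negligible (frontier (\<Delta> n))" for n
      unfolding \<Delta>_def using sq open_square_imp(2) by (intro negligible_frontier_Union_convex) auto
  qed fact
  moreover have "N' \<in> sets borel"
    unfolding N'_def by (intro sets.Un sets.countable_UN'') auto
  ultimately have "negligible {x. \<not> (AE y in lborel. (x, y) \<notin> N')}"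
    by (rule negligible_AE_section)
  moreover have "continuous (at x within {a..b}) F"
    if x: "x \<in> {a..b}" and N': "AE y in lborel. (x, y) \<notin> N'" for x
    unfolding continuous_within_sequentially
  proof (intro allI impI, elim conjE)
    fix \<tau> :: "nat \<Rightarrow> real" assume \<tau>: "\<forall>k. \<tau> k \<in> {a..b}" "\<tau> \<longlonglongrightarrow> x"
    have lim: "(\<lambda>k. H (\<tau> k, y)) \<longlonglongrightarrow> H (x, y)" if y: "(x, y) \<notin> N'" for y
    proof (cases "y \<in> {c..d}")
      case False
      then have "H (z, y) = 0" for z by (auto simp: H_def R_def indicator_def)
      then show ?thesis by simp
    next
      case True
      then have p: "(x, y) \<in> R" "\<And>k. (\<tau> k, y) \<in> R" using x \<tau> by (auto simp: R_def)
      obtain n where n: "(x, y) \<notin> \<Delta> n" using y by (auto simp: N'_def N_def)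
      \<comment> \<open>Here the frontiers in \<open>N'\<close> matter: missing
        \<open>\<Delta> n\<close> and its frontier means missing its closure. Hence all nearby
        points avoid \<open>\<Delta> n\<close>, thus also \<open>N\<close>, and in \<open>R\<close>
        the functions \<open>H\<close> and \<open>g\<close> agree near
        \<open>(x, y)\<close>.\<close>
      then have "(x, y) \<in> - closure (\<Delta> n)"
        using y \<open>open (\<Delta> n)\<close> by (auto simp: N'_def frontier_def interior_open)
      moreover have \<tau>y: "(\<lambda>k. (\<tau> k, y)) \<longlonglongrightarrow> (x, y)"
        using \<tau>(2) by (intro tendsto_intros)
      ultimately have "\<forall>\<^sub>F k in sequentially. (\<tau> k, y) \<in> - closure (\<Delta> n)"
        by (intro topological_tendstoD) auto
      then have ev: "\<forall>\<^sub>F k in sequentially. g (\<tau> k, y) = H (\<tau> k, y)"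
        by eventually_elim (use p closure_subset in \<open>auto simp: H_def N_def indicator_def\<close>)
      \<comment> \<open>Continuity relative to \<open>R\<close> suffices, since the points
        \<open>(\<tau> k, y)\<close> never leave \<open>R\<close>.\<close>
      have "(\<lambda>k. g (\<tau> k, y)) \<longlonglongrightarrow> g (x, y)"
        using g_cont[of "(x, y)" n] n p \<tau>y
        by (auto simp: continuous_within_sequentially o_def
            dest!: spec[of _ "\<lambda>k. (\<tau> k, y)"])
      moreover have "g (x, y) = H (x, y)"
        using n p by (auto simp: H_def N_def indicator_def)
      ultimately show ?thesis
        using Lim_transform_eventually[OF _ ev] by simp
    qed
    show "(F \<circ> \<tau>) \<longlonglongrightarrow> F x"
      unfolding o_def F_def
    proof (rule integral_dominated_convergence[where w = "\<lambda>y. B * indicator {c..d} y"])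
      show "AE y in lborel. (\<lambda>k. H (\<tau> k, y)) \<longlonglongrightarrow> H (x, y)"
        using N' by eventually_elim (rule lim)
      show "AE y in lborel. norm (H (\<tau> k, y)) \<le> B * indicator {c..d} y" for k
        using section_bound(1) \<tau>(1) by (intro AE_I2) blast
    qed (use int_bound in simp_all)
  qed
  then have "discontinuities {a..b} F \<subseteq> {x. \<not> (AE y in lborel. (x, y) \<notin> N')}"
    by (auto simp: discontinuities_def)
  ultimately have "negligible (discontinuities {a..b} F)"
    by (rule negligible_subset)
  moreover have "norm (F x) \<le> (\<integral>y. B * indicator {c..d} y \<partial>lborel)" if "x \<in> {a..b}" for x
    unfolding F_def
  proof (rule order_trans[OF integral_norm_bound integral_mono'[OF int_bound]])
    show "norm (H (x, y)) \<le> B * indicator {c..d} y" for y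
      by (rule section_bound(1)[OF that])
    then show "0 \<le> B * indicator {c..d} y" for y
      by (rule order_trans[OF norm_ge_zero])
  qed
  then have "bounded (F ` {a..b})"
    by (intro boundedI) (erule imageE, simp only:)
  moreover have "negligible (frontier {a..b})"
    by (intro negligible_convex_frontier) simp
  \<comment> \<open>The value is known so far only as the gauge integral of \<open>F\<close>; it
    remains to identify it with \<open>I\<close>.\<close>
  ultimately have F: "has_riemann_integral F (integral {a..b} F) {a..b}"
    using has_riemann_integral_negligible_discontinuities[OF bounded_closed_interval] by blast

  \<comment> \<open>Fubini and the value of the repeated integral\<close>
  have H_int: "integrable lborel H"
  proof (rule Bochner_Integration.integrable_bound)
    show "integrable lborel (\<lambda>p. B * indicator R p)"
      unfolding R using emeasure_lborel_cbox_finite[of "(a, c)" "(b, d)"]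
      by (intro integrable_mult_right integrable_real_indicator) (simp_all add: infinity_ennreal_def)
    show "AE p in lborel. norm (H p) \<le> norm (B * indicator R p)"
      unfolding real_norm_def[of "B * _"] by (intro AE_I2 order_trans[OF H_bound(1) abs_ge_self])
  qed simp
  then have H_pair: "integrable (lborel \<Otimes>\<^sub>M lborel) H"
    by (simp only: lborel_prod)
  have F_int: "integrable lborel F"
    unfolding F_def using H_pair by (rule lborel_pair.integrable_fst')
  have F_H: "(\<integral>x. F x \<partial>lborel) = (\<integral>p. H p \<partial>lborel)"
    unfolding F_def using lborel_pair.integral_fst'[OF H_pair] by (simp only: lborel_prod)
  \<comment> \<open>\<open>H\<close> vanishes off \<open>R\<close>. This passes from the interval to
    the whole line, where Fubini was applied.\<close>
  have "F x = 0" if "x \<notin> {a..b}" for x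
    using that by (simp add: F_def H_def R_def del: atLeastAtMost_iff)
  then have "(\<lambda>x. if x \<in> {a..b} then F x else 0) = F"
    by force
  then have "integral {a..b} F = integral UNIV F"
    by (metis integral_restrict_UNIV)
  also have "\<dots> = (\<integral>p. H p \<partial>lborel)"
    using integral_lborel[OF F_int] F_H by simp
  also have "\<dots> = I"
  proof -
    \<comment> \<open>On \<open>R\<close> the functions \<open>H\<close> and \<open>g\<close> differ
      only on the negligible set \<open>N\<close>, so \<open>H\<close> inherits the integral of
      \<open>g\<close>.\<close>
    have "(H has_integral I) R"
      using \<open>negligible N\<close> _ has_riemann_integral_cbox_imp_has_integral[OF g, folded R]
      by (rule has_integral_spike) (simp add: H_def)
    then have "(H has_integral I) UNIV"
      by (rule has_integral_on_superset) (auto simp: H_def)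
    then show ?thesis
      using has_integral_integral_lborel[OF H_int] has_integral_unique by blast
  qed
  finally have "has_riemann_integral F I {a..b}"
    using F by simp
  \<comment> \<open>Riemann integrability over the interval depends only on the extension by 0, so
    the equality with \<open>F\<close> on the interval is enough.\<close>
  moreover have "zero_ext {a..b} (\<lambda>x. improper_riemann_integral (\<Omega>n x) (\<lambda>y. g (x, y))) = zero_ext {a..b} F"
    using improper by (auto simp: zero_ext_def)
  ultimately have J: "has_riemann_integral (\<lambda>x. improper_riemann_integral (\<Omega>n x) (\<lambda>y. g (x, y))) I {a..b}"
    by (simp add: has_riemann_integral_def)
  then show ?thesis
    using \<open>\<And>x. x \<in> {a..b} \<Longrightarrow> improper_riemann_integrable (\<Omega>n x) (\<Omega>x x) (\<lambda>y. g (x, y))\<close>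
      J riemann_integral_eq[OF I] riemann_integral_eq[OF J]
    by (auto simp: riemann_integrable_def)
qed

end
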